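(* Let $A$ be an $n\times n$ row stochastic and irreducible matrix. For any network node $j\in\{1,\dots,n\}$, the pair $(A,B_j)$, with $B_j=e_j$, is stabilizable.
   Context: Row stochastic means nonnegative entries with rows summing to one. $e_j$ is the $j$-th canonical basis vector of $\mathbb{R}^n$. Stabilizability is in the discrete-time sense: there are no $\lambda\in\mathbb{C}$ with $|\lambda|\ge1$ and nonzero row vector $w$ such that $wA=\lambda w$ and $wB_j=0$. *)

theory Defs
  imports "HOL-Analysis.Analysis"
begin

definition row_stochastic :: "real ^ 'n ^ 'n \<Rightarrow> bool" where
  "row_stochastic A \<longleftrightarrow>
     (\<forall>i j. 0 \<le> A $ i $ j) \<and> (\<forall>i. (\<Sum>j\<in>UNIV. A $ i $ j) = 1)"

definition matrix_digraph :: "real ^ 'n ^ 'n \<Rightarrow> ('n \<times> 'n) set" where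
  "matrix_digraph A = {(i, j). A $ i $ j \<noteq> 0}"

(* Irreducible means that the network is strongly connected. Paths have length at least 1,
   so the 1 x 1 zero matrix (which is not row stochastic) is not irreducible here. *)
definition irreducible_matrix :: "real ^ 'n ^ 'n \<Rightarrow> bool" where
  "irreducible_matrix A \<longleftrightarrow> (\<forall>i j. (i, j) \<in> (matrix_digraph A)\<^sup>+)"

(* Discrete-time stabilizability in Hautus form. B is an n x m input matrix; real matrices
   act on complex row vectors after entrywise embedding into the complex numbers. *)
definition stabilizable :: "real ^ 'n ^ 'n \<Rightarrow> real ^ 'm ^ 'n \<Rightarrow> bool" where
  "stabilizable A B \<longleftrightarrow>
     \<not> (\<exists>(z :: complex) (w :: complex ^ 'n).
          cmod z \<ge> 1 \<and> w \<noteq> 0 \<and>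
          w v* map_matrix complex_of_real A = z *s w \<and>
          w v* map_matrix complex_of_real B = 0)"

definition input_matrix :: "'n \<Rightarrow> real ^ 1 ^ 'n" where
  "input_matrix j = columnvector (axis j 1)"

end

theory Submission
  imports Defs
begin

text \<open>
  If \<open>w A = z w\<close> with \<open>cmod z \<ge> 1\<close>, then the vector \<open>v\<close> of moduli of \<open>w\<close> satisfies \<open>v \<le> v A\<close>
  entrywise by the triangle inequality. Both sides have the same total mass because the rows of \<open>A\<close>
  sum to one, so \<open>v = v A\<close>. Hence the zero set of \<open>v\<close> is closed under predecessors in the digraph
  of \<open>A\<close>. The condition \<open>w B = 0\<close> puts \<open>j\<close> in this set, and strong connectivity gives \<open>w = 0\<close>.
\<close>

lemma row_stochastic_subinvariant_imp_invariant:
  fixes A :: "real ^ 'n ^ 'n" and v :: "real ^ 'n"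
  assumes "row_stochastic A" and le: "\<And>j. v $ j \<le> (v v* A) $ j"
  shows "v v* A = v"
proof -
  have "(\<Sum>j\<in>UNIV. (v v* A) $ j) = (\<Sum>j\<in>UNIV. \<Sum>i\<in>UNIV. A $ i $ j * v $ i)"
    by (simp add: vector_matrix_mult_def mult.commute)
  also have "\<dots> = (\<Sum>i\<in>UNIV. \<Sum>j\<in>UNIV. A $ i $ j * v $ i)"
    by (rule sum.swap)
  also have "\<dots> = (\<Sum>i\<in>UNIV. v $ i)"
    using assms(1) by (simp add: row_stochastic_def flip: sum_distrib_right)
  finally have "(\<Sum>j\<in>UNIV. (v v* A) $ j - v $ j) = 0"
    by (simp add: sum_subtractf)
  \<comment> \<open>The gaps are nonnegative by \<open>le\<close> and sum to zero, so none can be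
    positive.\<close>
  then have "\<forall>j\<in>UNIV. (v v* A) $ j - v $ j = 0"
    using le by (subst (asm) sum_nonneg_eq_0_iff) auto
  then show ?thesis
    by (simp add: vec_eq_iff)
qed

text \<open>A zero entry \<open>v $ l\<close> is, by invariance, a sum of nonnegative terms
  \<open>A $ k $ l * v $ k\<close>. All of them vanish, so an edge from k to l forces
  \<open>v $ k = 0\<close>.\<close>

lemma invariant_zero_predecessor:
  fixes A :: "real ^ 'n ^ 'n" and v :: "real ^ 'n"
  assumes A: "\<And>i j. 0 \<le> A $ i $ j" and v: "\<And>i. 0 \<le> v $ i" and inv: "v v* A = v"
    and path: "(i, j) \<in> (matrix_digraph A)\<^sup>+" and "v $ j = 0"
  shows "v $ i = 0"
proof -
  have edge: "v $ k = 0" if "(k, l) \<in> matrix_digraph A" "v $ l = 0" for k l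
  proof -
    have "(\<Sum>i\<in>UNIV. A $ i $ l * v $ i) = (v v* A) $ l"
      by (simp add: vector_matrix_mult_def mult.commute)
    also have "\<dots> = 0"
      using inv that(2) by simp
    finally have "A $ k $ l * v $ k = 0"
      using A v by (subst (asm) sum_nonneg_eq_0_iff) auto
    then show ?thesis
      using that(1) by (simp add: matrix_digraph_def)
  qed
  show ?thesis
    \<comment> \<open>Zeros pass from the head of an edge to its tail, so the induction fixes the
      end j and extends the path at its start.\<close>
    using path \<open>v $ j = 0\<close> by (induction rule: converse_trancl_induct) (auto intro: edge)
qed

lemma cmod_left_eigenvector_subinvariant:
  fixes A :: "real ^ 'n ^ 'n" and w :: "complex ^ 'n"
  assumes A: "\<And>i j. 0 \<le> A $ i $ j" and "cmod z \<ge> 1"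
    and eig: "w v* map_matrix complex_of_real A = z *s w"
  shows "cmod (w $ j) \<le> ((\<chi> i. cmod (w $ i)) v* A) $ j"
proof -
  \<comment> \<open>The bound on the eigenvalue enters here; an eigenvalue inside the unit disc
    would not give this.\<close>
  have "cmod (w $ j) \<le> cmod z * cmod (w $ j)"
    using \<open>cmod z \<ge> 1\<close> by (simp add: mult_right_le_one_le mult_le_cancel_right1)
  also have "\<dots> = cmod ((w v* map_matrix complex_of_real A) $ j)"
    by (simp add: eig norm_mult)
  also have "\<dots> = cmod (\<Sum>i\<in>UNIV. complex_of_real (A $ i $ j) * w $ i)"
    by (simp add: vector_matrix_mult_def map_matrix_def mult.commute)
  also have "\<dots> \<le> (\<Sum>i\<in>UNIV. A $ i $ j * cmod (w $ i))"
    using A by (intro sum_norm_le) (simp add: norm_mult)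
  finally show ?thesis
    by (simp add: vector_matrix_mult_def mult.commute)
qed

text \<open>The only column of the input matrix is the basis vector at j, so the product picks out
  \<open>w $ j\<close>.\<close>

lemma vector_mult_input_matrix:
  fixes w :: "complex ^ 'n"
  shows "(w v* map_matrix complex_of_real (input_matrix j)) $ k = w $ j"
  by (simp add: vector_matrix_mult_def map_matrix_def input_matrix_def columnvector_def axis_def
      if_distrib cong: if_cong)

theorem lemmaV2:
  fixes A :: "real ^ 'n ^ 'n"
  assumes "row_stochastic A"
    and "irreducible_matrix A"
  shows "\<forall>j :: 'n. stabilizable A (input_matrix j)"
proof
  fix j :: 'n
  have A: "0 \<le> A $ i $ k" for i k
    using assms(1) by (simp add: row_stochastic_def)
  have "w = 0" if "cmod z \<ge> 1" and eig: "w v* map_matrix complex_of_real A = z *s w"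
    and B: "w v* map_matrix complex_of_real (input_matrix j) = 0" for z and w :: "complex ^ 'n"
  proof -
    define v :: "real ^ 'n" where "v = (\<chi> i. cmod (w $ i))"
    have "v v* A = v"
      using row_stochastic_subinvariant_imp_invariant[OF assms(1)]
        cmod_left_eigenvector_subinvariant[OF A that(1) eig]
      by (simp add: v_def)
    moreover have "v $ j = 0"
      using vector_mult_input_matrix[of w j] B by (simp add: v_def)
    ultimately have "v $ i = 0" for i
      using invariant_zero_predecessor[of A v i j] A assms(2)
      by (simp add: v_def irreducible_matrix_def)
    then show ?thesis
      by (simp add: v_def vec_eq_iff)
  qed
  then show "stabilizable A (input_matrix j)"
    by (auto simp: stabilizable_def)
qed

end
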